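(* Let $(A,+)$ and $(B,+)$ be Abelian groups, both of order $n$, and let $f:A\to B$ be a function with perfect nonlinearity $P_{f}=\frac{1}{n}$. For $b\in B$ define $C_{b}=\{x\in A: f(x)=b\}$, and let $C=\bigcup_{b\in B}\{b\}\times C_{b}\subseteq B\times A$. Then $C$ is a partial geometric difference set in $B\times A$ with parameters $(n^{2},n;2n-1,n-1)$.
   Context: For a function $f:A\to B$ between finite Abelian groups with $|B|=m$, set $P_{f}=\max_{0\neq a\in A}\max_{b\in B}\Pr_{x}(f(x+a)-f(x)=b)$, where $x$ is uniformly distributed in $A$; $f$ has perfect nonlinearity if $P_{f}=\frac{1}{m}$. Let $G$ be a finite additive Abelian group of order $v$. For $S\subseteq G$ and $z\in G$, let $\delta_{S}(z)=|\{(x,y)\in S\times S: z=x-y\}|$. Let $v>k>2$ be integers. A $k$-subset $S\subseteq G$ is a partial geometric difference set with parameters $(v,k;\alpha,\beta)$ if there are constants $\alpha,\beta$ such that for every $x\in G$, $\sum_{y\in S}\delta_{S}(x-y)=\alpha$ if $x\in S$ and $=\beta$ if $x\notin S$. *)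

theory Defs
  imports "HOL-Probability.Probability_Mass_Function" "HOL-Library.Product_Plus"
begin

text \<open>Only meaningful for nontrivial \<open>'a\<close>: for the trivial group the outer maximum is over the
  empty set and hence unspecified.\<close>

definition max_derivative_prob ::
    "('a::{finite,ab_group_add} \<Rightarrow> 'b::{finite,ab_group_add}) \<Rightarrow> real" where
  "max_derivative_prob f =
     Max ((\<lambda>a. Max (range (\<lambda>b.
       measure_pmf.prob (pmf_of_set UNIV) {x. f (x + a) - f x = b}))) ` {a. a \<noteq> 0})"

definition has_perfect_nonlinearity ::
    "('a::{finite,ab_group_add} \<Rightarrow> 'b::{finite,ab_group_add}) \<Rightarrow> bool" where
  "has_perfect_nonlinearity f \<longleftrightarrow> max_derivative_prob f = 1 / real CARD('b)"

definition diff_count :: "'g::{finite,ab_group_add} set \<Rightarrow> 'g \<Rightarrow> nat" where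
  "diff_count S z = card {(x, y). (x, y) \<in> S \<times> S \<and> z = x - y}"

definition partial_geometric_difference_set ::
    "'g::{finite,ab_group_add} set \<Rightarrow> nat \<Rightarrow> nat \<Rightarrow> nat \<Rightarrow> nat \<Rightarrow> bool" where
  "partial_geometric_difference_set S v k \<alpha> \<beta> \<longleftrightarrow>
     CARD('g) = v \<and> v > k \<and> k > 2 \<and> card S = k \<and>
     (\<forall>x. (\<Sum>y\<in>S. diff_count S (x - y)) = (if x \<in> S then \<alpha> else \<beta>))"

end

theory Submission
  imports Defs
begin

text \<open>For groups of equal order, perfect nonlinearity forces every derivative
  \<open>x \<mapsto> f (x + a) - f x\<close> with \<open>a \<noteq> 0\<close> to be injective, hence bijective. So, for the graph \<open>C\<close>
  of \<open>f\<close>, a difference \<open>(u, w)\<close> with \<open>w \<noteq> 0\<close> is represented exactly once. In the sum over the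
  points \<open>(f y, y)\<close> of \<open>C\<close>, the \<open>n - 1\<close> points with \<open>y \<noteq> w\<close> contribute 1 each, and the point with
  \<open>y = w\<close> contributes \<open>n\<close> or \<open>0\<close> according to whether \<open>(u, w)\<close> lies in \<open>C\<close>. The order \<open>2\<close> does not
  occur, since there a derivative takes the values \<open>c\<close> and \<open>- c = c\<close>.\<close>

text \<open>Each fibre of the derivative has probability at most \<open>1 / CARD('b)\<close>; since
  the orders agree, this leaves room for at most one point per fibre.\<close>

lemma perfect_nonlinearity_imp_bij_derivative:
  fixes f :: "'a::{finite,ab_group_add} \<Rightarrow> 'b::{finite,ab_group_add}"
  assumes card: "CARD('a) = CARD('b)" and pn: "has_perfect_nonlinearity f" and a: "a \<noteq> 0"
  shows "bij (\<lambda>x. f (x + a) - f x)"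
proof -
  have "card {x. f (x + a) - f x = b} \<le> 1" for b
  proof -
    let ?p = "\<lambda>a b. measure_pmf.prob (pmf_of_set UNIV) {x. f (x + a) - f x = b}"
    have "?p a b \<le> Max (range (?p a))"
      by (intro Max_ge) auto
    also have "\<dots> \<le> max_derivative_prob f"
      unfolding max_derivative_prob_def using a by (intro Max_ge) auto
    also have "\<dots> = 1 / real CARD('a)"
      using pn card unfolding has_perfect_nonlinearity_def by simp
    finally have "real (card {x. f (x + a) - f x = b}) / real CARD('a) \<le> 1 / real CARD('a)"
      by (simp add: measure_pmf_of_set)
    then show ?thesis
      by (simp add: divide_le_cancel)
  qed
  then have "inj (\<lambda>x. f (x + a) - f x)"
    by (auto intro!: injI simp: card_le_Suc0_iff_eq)
  moreover from this have "range (\<lambda>x. f (x + a) - f x) = UNIV"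
    using card by (intro card_subset_eq) (auto simp: card_image)
  ultimately show ?thesis
    by (rule bijI)
qed

lemma add_self_eq_0_of_card_2:
  fixes x :: "'g::{finite,ab_group_add}"
  assumes "CARD('g) = 2"
  shows "x + x = 0"
proof (cases "x = 0")
  case False
  then have "{0, x} = (UNIV :: 'g set)"
    using assms by (intro card_subset_eq) auto
  then have "x + x \<in> {0, x}"
    by simp
  with False show ?thesis
    by simp
qed simp

text \<open>Supplies the clause \<open>k > 2\<close> of the definition, which \<open>n > 1\<close>
  alone leaves open at \<open>n = 2\<close>.\<close>

lemma perfect_nonlinearity_imp_card_neq_2:
  fixes f :: "'a::{finite,ab_group_add} \<Rightarrow> 'b::{finite,ab_group_add}"
  assumes card: "CARD('a) = CARD('b)" and pn: "has_perfect_nonlinearity f"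
  shows "CARD('a) \<noteq> 2"
proof
  assume two: "CARD('a) = 2"
  have "\<exists>a :: 'a. a \<noteq> 0"
  proof (rule ccontr)
    assume "\<nexists>a :: 'a. a \<noteq> 0"
    then have "(UNIV :: 'a set) = {0}"
      by blast
    from arg_cong[OF this, of card] two show False
      by (simp only: card_1_singleton_iff) simp
  qed
  then obtain a :: 'a where a: "a \<noteq> 0"
    by blast
  have "a + a = 0"
    using two by (rule add_self_eq_0_of_card_2)
  moreover have "(f a - f 0) + (f a - f 0) = 0"
    using two card by (intro add_self_eq_0_of_card_2) simp
  then have "f a - f 0 = f 0 - f a"
    by (simp add: algebra_simps)
  \<comment> \<open>As \<open>a + a = 0\<close>, the right side is \<open>f 0 - f a\<close>, the
    negative of the left side, and signs do not matter in order 2.\<close>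
  ultimately have "f (0 + a) - f 0 = f (a + a) - f a"
    by simp
  then have "0 = a"
    by (rule injD[OF bij_is_inj[OF perfect_nonlinearity_imp_bij_derivative[OF card pn a]]])
  with a show False
    by simp
qed

text \<open>The argument \<open>t\<close> of the subtracted point determines the pair, since the
  other argument must be \<open>t + w\<close>.\<close>

lemma diff_count_graph:
  fixes f :: "'a::{finite,ab_group_add} \<Rightarrow> 'b::{finite,ab_group_add}"
  shows "diff_count (range (\<lambda>x. (f x, x))) (u, w) = card {t. f (t + w) - f t = u}"
proof -
  have "bij_betw (\<lambda>t. ((f (t + w), t + w), (f t, t))) {t. f (t + w) - f t = u}
      {(x, y). (x, y) \<in> range (\<lambda>x. (f x, x)) \<times> range (\<lambda>x. (f x, x)) \<and> (u, w) = x - y}"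
    by (rule bij_betwI[where g = "snd \<circ> snd"]) auto
  then show ?thesis
    unfolding diff_count_def by (rule bij_betw_same_card[symmetric])
qed

text \<open>For \<open>w = 0\<close> the derivative is constantly \<open>0\<close>, so either every
  \<open>t\<close> represents \<open>(u, 0)\<close> or none does.\<close>

lemma diff_count_graph_of_bij_derivative:
  fixes f :: "'a::{finite,ab_group_add} \<Rightarrow> 'b::{finite,ab_group_add}"
  assumes "\<And>a. a \<noteq> 0 \<Longrightarrow> bij (\<lambda>x. f (x + a) - f x)"
  shows "diff_count (range (\<lambda>x. (f x, x))) (u, w) =
    (if w \<noteq> 0 then 1 else if u = 0 then CARD('a) else 0)"
proof (cases "w = 0")
  case False
  then have "\<exists>!t. f (t + w) - f t = u"
    using bij_iff[THEN iffD1, OF assms] by simp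
  then obtain t where "{t. f (t + w) - f t = u} = {t}"
    by blast
  with False show ?thesis
    by (simp add: diff_count_graph)
qed (auto simp: diff_count_graph)

theorem theorem3p7:
  fixes f :: "'a::{finite,ab_group_add} \<Rightarrow> 'b::{finite,ab_group_add}" and n :: nat
  assumes "CARD('a) = n" and "CARD('b) = n" and "n > 1"
    and "has_perfect_nonlinearity f"
  shows "partial_geometric_difference_set
           (\<Union>b\<in>UNIV. {b} \<times> {x. f x = b} :: ('b \<times> 'a) set)
           (n\<^sup>2) n (2 * n - 1) (n - 1)"
proof -
  let ?C = "range (\<lambda>x. (f x, x))"
  have C: "(\<Union>b\<in>UNIV. {b} \<times> {x. f x = b}) = ?C"
    by auto
  have inj: "inj (\<lambda>x. (f x, x))"
    by (simp add: inj_on_def)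
  have card: "CARD('a) = CARD('b)"
    using assms by simp
  have "n \<noteq> 2"
    using perfect_nonlinearity_imp_card_neq_2[OF card assms(4)] assms(1) by simp
  with \<open>n > 1\<close> have n: "n > 2"
    by simp
  have sum: "(\<Sum>p\<in>?C. diff_count ?C (q - p)) = (if q \<in> ?C then 2 * n - 1 else n - 1)" for q
  proof -
    obtain u w where q: "q = (u, w)"
      by fastforce
    have "(\<Sum>p\<in>?C. diff_count ?C (q - p)) = (\<Sum>y\<in>UNIV. diff_count ?C (u - f y, w - y))"
      by (simp add: sum.reindex[OF inj] q)
    \<comment> \<open>At \<open>y = w\<close> the difference is \<open>(u - f w, 0)\<close>, which
      vanishes exactly when \<open>q\<close> lies on the graph.\<close>
    also have "\<dots> = (\<Sum>y\<in>UNIV. if y \<noteq> w then 1 else if u = f w then n else 0)"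
      using perfect_nonlinearity_imp_bij_derivative[OF card assms(4)] assms(1)
      by (intro sum.cong refl) (auto simp: diff_count_graph_of_bij_derivative)
    also have "\<dots> = (if u = f w then n else 0) + (\<Sum>y\<in>UNIV - {w}. 1)"
      by (subst sum.remove[of _ w]) auto
    also have "\<dots> = (if q \<in> ?C then 2 * n - 1 else n - 1)"
      using assms(1,3) by (auto simp: q card_Diff_singleton)
    finally show ?thesis .
  qed
  have "n < n\<^sup>2"
    using \<open>n > 1\<close> by (simp add: power2_eq_square)
  then show ?thesis
    unfolding partial_geometric_difference_set_def C
    using n sum assms(1,2) by (simp add: card_image[OF inj] power2_eq_square)
qed

end
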